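(* Let $\rho$ be the unique real number $s>1$ with $\zeta(s)=2$, where $\zeta$ is the Riemann zeta function. Then for all positive integers $n$, \[ b(n)\le n^{\rho}\qquad\text{and}\qquad a(n)\le 2n^{\rho}. \]
   Context: For a positive integer $n$, $a(n)$ denotes the number of partitions of $n$ of the form $n=a_1+a_2+\cdots+a_k$ (with $k\ge 1$ arbitrary and the $a_i$ positive integers) in which $a_{i+1}$ is a proper divisor of $a_i$ for all $i<k$; equivalently, partitions into distinct parts in which every part is a multiple of the next part. $b(n)$ denotes the number of those partitions counted by $a(n)$ whose last (smallest) part $a_k$ is not $1$. *)

theory Defs
  imports Complex_Main
begin

text \<open>The Riemann zeta function on the half-line \<open>s > 1\<close>, where it is the sum of its Dirichlet
  series. For \<open>s \<le> 1\<close> the series diverges and the value is unspecified.\<close>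

definition zeta_real :: "real \<Rightarrow> real" where
  "zeta_real s = (\<Sum>n. 1 / real (Suc n) powr s)"

definition zeta_two :: real where
  "zeta_two = (THE s. s > 1 \<and> zeta_real s = 2)"

text \<open>A partition \<open>n = a\<^sub>1 + \<dots> + a\<^sub>k\<close> is represented by its list of parts \<open>[a\<^sub>1, \<dots>, a\<^sub>k]\<close>,
  which the divisibility condition forces to be strictly decreasing.\<close>

definition divisor_partitions :: "nat \<Rightarrow> nat list set" where
  "divisor_partitions n =
     {xs. xs \<noteq> [] \<and> (\<forall>x\<in>set xs. 0 < x) \<and> sum_list xs = n \<and>
          (\<forall>i. Suc i < length xs \<longrightarrow> xs ! Suc i dvd xs ! i \<and> xs ! Suc i \<noteq> xs ! i)}"

definition a_count :: "nat \<Rightarrow> nat" where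
  "a_count n = card (divisor_partitions n)"

definition b_count :: "nat \<Rightarrow> nat" where
  "b_count n = card {xs \<in> divisor_partitions n. last xs \<noteq> 1}"

text \<open>Finiteness, so that \<open>card\<close> really counts.\<close>

lemma finite_divisor_partitions: "finite (divisor_partitions n)"
proof (rule finite_subset)
  have len: "length xs \<le> sum_list xs" if "\<forall>x\<in>set xs. 0 < x" for xs :: "nat list"
    using that by (induction xs) auto
  show "divisor_partitions n \<subseteq> {xs. set xs \<subseteq> {..n} \<and> length xs \<le> n}"
    using len by (auto simp: divisor_partitions_def intro: member_le_sum_list)
  show "finite {xs. set xs \<subseteq> {..n} \<and> length xs \<le> n}"
    by (rule finite_lists_length_le) simp
qed

end

theory Submission
  imports Defs "HOL-Analysis.Analysis"
begin

text \<open>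
  Call \<open>c n\<close> the number of partitions counted by \<open>a n\<close> whose last part is \<open>1\<close>, so that
  \<open>a n = b n + c n\<close>. The last part \<open>d\<close> of such a partition divides all parts, so dividing by it
  turns a partition of \<open>n\<close> with last part \<open>d\<close> into a partition of \<open>n / d\<close> with last part \<open>1\<close>.
  Hence \<open>b n\<close> is at most the sum of \<open>c (n / d)\<close> over the divisors \<open>d > 1\<close> of \<open>n\<close>
  (\<open>b_count_le_sum\<close>). Dropping a last part \<open>1\<close> leaves a partition of \<open>n - 1\<close> whose last part
  is not \<open>1\<close>, so \<open>c n \<le> b (n - 1)\<close> for \<open>n \<ge> 2\<close> (\<open>card_last_one_le\<close>), while \<open>c 1 = 1\<close>.

  If \<open>b m \<le> m powr \<rho>\<close> for all smaller \<open>m \<ge> 1\<close>, then \<open>c (n / d) \<le> (n / d) powr \<rho>\<close> for each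
  divisor \<open>d > 1\<close> of \<open>n\<close>, and summing over \<open>d\<close> gives
  \<open>b n \<le> n powr \<rho> * (zeta \<rho> - 1) = n powr \<rho>\<close>. The equation \<open>zeta \<rho> = 2\<close> is what makes this
  induction close (\<open>sum_divisors_powr_zeta_two_le\<close>). Then also \<open>c n \<le> n powr \<rho>\<close>, which gives
  the factor \<open>2\<close> in the bound for \<open>a n\<close>.

  The number \<open>\<rho>\<close> exists and is unique because zeta is continuous and strictly decreasing on
  \<open>s > 1\<close>, exceeds \<open>2\<close> close to \<open>1\<close>, and is at most \<open>2\<close> at \<open>2\<close>.
\<close>

section \<open>The equation \<open>zeta s = 2\<close>\<close>

lemma summable_zeta_real:
  assumes "s > 1"
  shows "summable (\<lambda>n. 1 / real (Suc n) powr s)"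
proof -
  have "summable (\<lambda>n. real n powr (- s))"
    using assms by (simp add: summable_real_powr_iff)
  then have "summable (\<lambda>n. real (Suc n) powr (- s))"
    by (subst summable_Suc_iff)
  then show ?thesis
    by (simp add: powr_minus_divide)
qed

lemma zeta_real_strict_antimono:
  assumes "1 < s" "s < t"
  shows "zeta_real t < zeta_real s"
proof -
  have "0 < (\<Sum>n. 1 / real (Suc n) powr s - 1 / real (Suc n) powr t)"
  proof (rule suminf_pos2)
    show "summable (\<lambda>n. 1 / real (Suc n) powr s - 1 / real (Suc n) powr t)"
      using assms by (intro summable_diff summable_zeta_real) auto
    show "0 \<le> 1 / real (Suc n) powr s - 1 / real (Suc n) powr t" for n
      using assms by (auto intro!: divide_left_mono powr_mono)
    show "0 < 1 / real (Suc 1) powr s - 1 / real (Suc 1) powr t"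
      using assms by (auto intro!: divide_strict_left_mono powr_less_mono)
  qed
  also have "\<dots> = zeta_real s - zeta_real t"
    unfolding zeta_real_def
    using assms by (intro suminf_diff [symmetric] summable_zeta_real) auto
  finally show ?thesis by simp
qed

lemma continuous_on_zeta_real:
  assumes "1 < s"
  shows "continuous_on {s..} zeta_real"
proof -
  have "uniform_limit {s..} (\<lambda>N t. \<Sum>n<N. 1 / real (Suc n) powr t)
          (\<lambda>t. \<Sum>n. 1 / real (Suc n) powr t) sequentially"
  proof (rule Weierstrass_m_test)
    show "summable (\<lambda>n. 1 / real (Suc n) powr s)"
      using assms by (rule summable_zeta_real)
    show "norm (1 / real (Suc n) powr t) \<le> 1 / real (Suc n) powr s" if "t \<in> {s..}" for n t
      using that by (auto intro!: divide_left_mono powr_mono)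
  qed
  then have "continuous_on {s..} (\<lambda>t. \<Sum>n. 1 / real (Suc n) powr t)"
    by (rule uniform_limit_theorem [rotated])
      (auto intro!: always_eventually continuous_intros)
  then show ?thesis
    by (simp add: zeta_real_def [abs_def])
qed

text \<open>The estimate \<open>1 / k\<^sup>2 \<le> 2 / (k * (k + 1))\<close> compares the series with a telescoping one.\<close>

lemma zeta_real_2_le: "zeta_real 2 \<le> 2"
proof -
  have "(\<lambda>n. 1 / real (Suc n)) \<longlonglongrightarrow> 0"
    using LIMSEQ_inverse_real_of_nat by (simp add: inverse_eq_divide)
  then have "(\<lambda>n. 1 / real (Suc n) - 1 / real (Suc (Suc n))) sums (1 - 0)"
    using telescope_sums' [of "\<lambda>n. 1 / real (Suc n)" 0] by simp
  then have tele: "(\<lambda>n. 2 * (1 / real (Suc n) - 1 / real (Suc (Suc n)))) sums (2 * 1)"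
    by (intro sums_mult) simp
  have "zeta_real 2 \<le> (\<Sum>n. 2 * (1 / real (Suc n) - 1 / real (Suc (Suc n))))"
    unfolding zeta_real_def
  proof (rule suminf_le)
    show "1 / real (Suc n) powr 2 \<le> 2 * (1 / real (Suc n) - 1 / real (Suc (Suc n)))" for n
      by (simp add: divide_simps power2_eq_square)
  qed (use tele summable_zeta_real [of 2] in \<open>auto simp: sums_iff\<close>)
  with tele show ?thesis by (simp add: sums_iff)
qed

text \<open>Already \<open>1 + 1/2 + 1/3 + 1/4 > 2\<close>, and this finite sum depends continuously on the exponent.\<close>

lemma zeta_real_ge_2: "\<exists>s>1. s \<le> 2 \<and> 2 \<le> zeta_real s"
proof -
  define f where "f s = (\<Sum>n<4. 1 / real (Suc n) powr s)" for s
  have "isCont f 1"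
    unfolding f_def by (intro continuous_intros) auto
  then have "(f \<longlongrightarrow> f 1) (at_right 1)"
    unfolding isCont_def by (rule filterlim_at_split [THEN iffD1, THEN conjunct2])
  moreover have "f 1 > 2"
    by (simp add: f_def eval_nat_numeral)
  ultimately have "\<forall>\<^sub>F s in at_right 1. f s > 2"
    by (rule order_tendstoD)
  moreover have "\<forall>\<^sub>F s in at_right 1. s \<in> {1<..<2::real}"
    by (intro eventually_at_right_real) simp
  ultimately have "\<forall>\<^sub>F s in at_right 1. f s > 2 \<and> s \<in> {1<..<2}"
    by (rule eventually_conj)
  then obtain s where s: "f s > 2" "1 < s" "s < 2"
    using eventually_happens by (fastforce simp: trivial_limit_at_right_real)
  have "f s \<le> zeta_real s"
    unfolding f_def zeta_real_def
    using s by (intro sum_le_suminf summable_zeta_real) auto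
  with s show ?thesis by force
qed

lemma ex1_zeta_real_eq_2: "\<exists>!s. s > 1 \<and> zeta_real s = 2"
proof -
  obtain s where s: "1 < s" "s \<le> 2" "2 \<le> zeta_real s"
    using zeta_real_ge_2 by blast
  have "\<exists>x\<ge>s. x \<le> 2 \<and> zeta_real x = 2"
    using s zeta_real_2_le
    by (intro IVT2' continuous_on_subset [OF continuous_on_zeta_real [of s]]) auto
  then obtain x where "x \<ge> s" "zeta_real x = 2"
    by blast
  with s have x: "x > 1 \<and> zeta_real x = 2"
    by simp
  have "y = x" if "y > 1 \<and> zeta_real y = 2" for y
    using x that zeta_real_strict_antimono [of x y] zeta_real_strict_antimono [of y x]
    by (cases x y rule: linorder_cases) auto
  with x show ?thesis by blast
qed

lemma zeta_two: "1 < zeta_two" "zeta_real zeta_two = 2"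
  using theI' [OF ex1_zeta_real_eq_2] unfolding zeta_two_def [symmetric] by auto

text \<open>The divisors \<open>d > 1\<close> contribute to \<open>zeta \<rho> - 1\<close> only some of its terms \<open>1 / d powr \<rho>\<close>, so
  their sum is at most \<open>1\<close>.\<close>

lemma sum_divisors_powr_zeta_two_le:
  "(\<Sum>d | d dvd n \<and> 1 < d. real (n div d) powr zeta_two) \<le> real n powr zeta_two"
proof (cases "n = 0")
  case False
  let ?D = "{d. d dvd n \<and> 1 < d}"
  \<comment> \<open>The series is indexed from \<open>0\<close>: the divisor \<open>d\<close> is term \<open>d - 1\<close>, and term \<open>0\<close> is the \<open>1\<close>.\<close>
  let ?E = "(\<lambda>d. d - 1) ` ?D"
  let ?f = "\<lambda>k. 1 / real (Suc k) powr zeta_two"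
  have fin: "finite ?D"
    using False by (auto intro: finite_subset [OF _ finite_divisors_nat [of n]])
  have inj: "inj_on (\<lambda>d. d - 1) ?D"
    by (auto simp: inj_on_def)
  have "1 + (\<Sum>d\<in>?D. 1 / real d powr zeta_two) = ?f 0 + sum ?f ?E"
    by (subst sum.reindex [OF inj]) (auto intro!: sum.cong)
  also have "\<dots> = sum ?f (insert 0 ?E)"
    using fin by (subst sum.insert) auto
  also have "\<dots> \<le> zeta_real zeta_two"
    unfolding zeta_real_def
    using fin zeta_two by (intro sum_le_suminf summable_zeta_real) auto
  finally have le: "(\<Sum>d\<in>?D. 1 / real d powr zeta_two) \<le> 1"
    using zeta_two by simp
  have "(\<Sum>d\<in>?D. real (n div d) powr zeta_two)
          = real n powr zeta_two * (\<Sum>d\<in>?D. 1 / real d powr zeta_two)"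
    unfolding sum_distrib_left
    by (intro sum.cong) (auto simp: real_of_nat_div powr_divide)
  also have "\<dots> \<le> real n powr zeta_two"
    using le by (intro mult_left_le) auto
  finally show ?thesis .
qed auto

section \<open>Recursive estimates for the partition counts\<close>

text \<open>Proper divisibility is transitive, so the condition on neighbouring parts extends to all pairs;
  this form makes mapping over a partition and removing its last part easy to handle.\<close>

lemma mem_divisor_partitions_iff:
  "xs \<in> divisor_partitions n \<longleftrightarrow>
     xs \<noteq> [] \<and> (\<forall>x\<in>set xs. 0 < x) \<and> sum_list xs = n \<and>
     sorted_wrt (\<lambda>x y. y dvd x \<and> y \<noteq> x) xs"
proof -
  have "transp (\<lambda>x y :: nat. y dvd x \<and> y \<noteq> x)"
    by (auto intro!: transpI dest: dvd_antisym intro: dvd_trans)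
  then show ?thesis
    by (simp add: divisor_partitions_def successively_conv_sorted_wrt [symmetric]
        successively_conv_nth)
qed

lemma card_last_one_le:
  assumes "n \<ge> 2"
  shows "card {xs \<in> divisor_partitions n. last xs = 1} \<le> b_count (n - 1)"
  unfolding b_count_def
proof (rule card_inj_on_le)
  show "inj_on butlast {xs \<in> divisor_partitions n. last xs = 1}"
    by (rule inj_onI) (metis (mono_tags, lifting) append_butlast_last_id mem_Collect_eq
        mem_divisor_partitions_iff)
  show "finite {xs \<in> divisor_partitions (n - 1). last xs \<noteq> 1}"
    using finite_divisor_partitions by simp
  show "butlast ` {xs \<in> divisor_partitions n. last xs = 1}
          \<subseteq> {xs \<in> divisor_partitions (n - 1). last xs \<noteq> 1}"
  proof safe
    fix xs
    assume xs: "xs \<in> divisor_partitions n" "last xs = 1"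
    then obtain ys where ys: "xs = ys @ [1]"
      by (metis append_butlast_last_id mem_divisor_partitions_iff)
    have ne: "ys \<noteq> []"
      using xs assms unfolding ys by (auto simp: mem_divisor_partitions_iff)
    then show "butlast xs \<in> divisor_partitions (n - 1)"
      using xs unfolding ys by (auto simp: mem_divisor_partitions_iff sorted_wrt_append)
    assume "last (butlast xs) = 1"
    then show False
      using xs ne last_in_set [OF ne] unfolding ys
      by (auto simp: mem_divisor_partitions_iff sorted_wrt_append)
  qed
qed

text \<open>For \<open>n = 1\<close> dropping the last part leaves the empty list, which \<open>b_count 0\<close> does not count, so
  \<open>card_last_one_le\<close> fails there.\<close>

lemma card_last_one_1: "card {xs \<in> divisor_partitions 1. last xs = 1} \<le> 1"
proof -
  have "{xs \<in> divisor_partitions 1. last xs = 1} \<subseteq> {[1]}"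
  proof safe
    fix xs
    assume xs: "xs \<in> divisor_partitions 1" "last xs = 1"
    then obtain ys where ys: "xs = ys @ [1]"
      by (metis append_butlast_last_id mem_divisor_partitions_iff)
    with xs show "xs = [1]"
      by (cases ys) (auto simp: mem_divisor_partitions_iff)
  qed
  from card_mono [OF _ this] show ?thesis
    by simp
qed

lemma b_count_le_sum:
  assumes "n \<ge> 1"
  shows "b_count n
           \<le> (\<Sum>d | d dvd n \<and> 1 < d. card {xs \<in> divisor_partitions (n div d). last xs = 1})"
proof -
  let ?D = "{d. d dvd n \<and> 1 < d}"
  let ?C = "\<lambda>m. {xs \<in> divisor_partitions m. last xs = 1}"
  have finD: "finite ?D"
    using assms by (auto intro: finite_subset [OF _ finite_divisors_nat [of n]])
  have finC: "finite (?C m)" for m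
    using finite_divisor_partitions by simp
  have sub: "{xs \<in> divisor_partitions n. last xs \<noteq> 1}
               \<subseteq> (\<Union>d\<in>?D. map ((*) d) ` ?C (n div d))"
  proof safe
    fix xs
    assume xs: "xs \<in> divisor_partitions n" "last xs \<noteq> 1"
    define d where "d = last xs"
    define ys where "ys = map (\<lambda>x. x div d) xs"
    have ne: "xs \<noteq> []"
      using xs by (simp add: mem_divisor_partitions_iff)
    then obtain zs where zs: "xs = zs @ [d]"
      unfolding d_def by (metis append_butlast_last_id)
    have d: "0 < d" "d \<noteq> 1"
      using xs by (auto simp: mem_divisor_partitions_iff zs)
    have dvd: "d dvd x" if "x \<in> set xs" for x
      using xs that by (auto simp: mem_divisor_partitions_iff zs sorted_wrt_append)
    have "map ((*) d) ys = xs"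
      using dvd by (auto simp: ys_def intro!: map_idI)
    note xs_eq = this [symmetric]
    have sum: "n = d * sum_list ys"
      using xs xs_eq by (auto simp: mem_divisor_partitions_iff sum_list_const_mult)
    have "ys \<in> divisor_partitions (n div d)"
      using xs d unfolding xs_eq sum by (auto simp: mem_divisor_partitions_iff sorted_wrt_map)
    moreover have "last ys = 1"
      using d by (simp add: ys_def zs)
    moreover have "d \<in> ?D"
      using d sum by auto
    ultimately show "xs \<in> (\<Union>d\<in>?D. map ((*) d) ` ?C (n div d))"
      using xs_eq by blast
  qed
  have "b_count n \<le> card (\<Union>d\<in>?D. map ((*) d) ` ?C (n div d))"
    unfolding b_count_def using finD finC by (intro card_mono sub) auto
  also have "\<dots> \<le> (\<Sum>d\<in>?D. card (map ((*) d) ` ?C (n div d)))"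
    by (rule card_UN_le [OF finD])
  also have "\<dots> \<le> (\<Sum>d\<in>?D. card (?C (n div d)))"
    by (intro sum_mono card_image_le finC)
  finally show ?thesis .
qed

lemma a_count_eq: "a_count n = b_count n + card {xs \<in> divisor_partitions n. last xs = 1}"
proof -
  have "divisor_partitions n =
      {xs \<in> divisor_partitions n. last xs \<noteq> 1} \<union> {xs \<in> divisor_partitions n. last xs = 1}"
    by auto
  then show ?thesis
    unfolding a_count_def b_count_def using finite_divisor_partitions
    by (subst card_Un_disjoint [symmetric]) auto
qed

section \<open>The bounds\<close>

lemma card_last_one_le_powr:
  assumes "m \<ge> 1" and "m \<ge> 2 \<Longrightarrow> real (b_count (m - 1)) \<le> real (m - 1) powr zeta_two"
  shows "real (card {xs \<in> divisor_partitions m. last xs = 1}) \<le> real m powr zeta_two"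
proof (cases "m = 1")
  case True
  then show ?thesis
    using card_last_one_1 by simp
next
  case False
  then have m: "m \<ge> 2"
    using assms by simp
  have "real (card {xs \<in> divisor_partitions m. last xs = 1}) \<le> real (b_count (m - 1))"
    using card_last_one_le [OF m] by simp
  also have "\<dots> \<le> real (m - 1) powr zeta_two"
    using assms m by simp
  also have "\<dots> \<le> real m powr zeta_two"
    using zeta_two by (intro powr_mono2) auto
  finally show ?thesis .
qed

lemma b_count_le_powr:
  assumes "n \<ge> 1"
  shows "real (b_count n) \<le> real n powr zeta_two"
  using assms
proof (induction n rule: less_induct)
  case (less n)
  let ?D = "{d. d dvd n \<and> 1 < d}"
  have "real (b_count n)
          \<le> (\<Sum>d\<in>?D. real (card {xs \<in> divisor_partitions (n div d). last xs = 1}))"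
    unfolding of_nat_sum [symmetric] using b_count_le_sum [OF less.prems] by (rule of_nat_mono)
  also have "\<dots> \<le> (\<Sum>d\<in>?D. real (n div d) powr zeta_two)"
  proof (intro sum_mono card_last_one_le_powr)
    fix d
    assume d: "d \<in> ?D"
    then show "n div d \<ge> 1"
      using less.prems by (auto elim!: dvdE)
    assume "n div d \<ge> 2"
    moreover have "n div d < n"
      using d less.prems by (intro div_less_dividend) auto
    ultimately show "real (b_count (n div d - 1)) \<le> real (n div d - 1) powr zeta_two"
      by (intro less.IH) auto
  qed
  also have "\<dots> \<le> real n powr zeta_two"
    by (rule sum_divisors_powr_zeta_two_le)
  finally show ?case .
qed

theorem mainTheorem3:
  shows "(\<exists>!s. s > 1 \<and> zeta_real s = 2) \<and>
         (\<forall>n::nat. n \<ge> 1 \<longrightarrow>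
            real (b_count n) \<le> real n powr zeta_two \<and>
            real (a_count n) \<le> 2 * real n powr zeta_two)"
proof (intro conjI allI impI)
  show "\<exists>!s. s > 1 \<and> zeta_real s = 2"
    by (rule ex1_zeta_real_eq_2)
next
  fix n :: nat
  assume n: "n \<ge> 1"
  show b: "real (b_count n) \<le> real n powr zeta_two"
    using n by (rule b_count_le_powr)
  have "real (card {xs \<in> divisor_partitions n. last xs = 1}) \<le> real n powr zeta_two"
    using n by (intro card_last_one_le_powr b_count_le_powr) auto
  with b show "real (a_count n) \<le> 2 * real n powr zeta_two"
    by (simp add: a_count_eq)
qed

end
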